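(* Let $a,b>0$ and let $E=\{(x,y)\in\mathbb{R}^2:\ x^2/a^2+y^2/b^2=1\}$. For a 3-periodic billiard trajectory in $E$, let $A$ be the area of the triangle $T$ formed by its vertices and let $A'$ be the area of the excentral triangle of $T$. Then the ratio $A'/A$ is the same for all 3-periodic billiard trajectories in $E$.
   Context: Elliptic billiard: a particle moves in straight lines at constant speed inside $E$ and bounces elastically on $E$, i.e. at each bounce point the incoming and outgoing segments make equal angles with the normal to $E$. A 3-periodic trajectory (orbit) is a closed billiard trajectory with three bounce points, that is, a non-degenerate triangle $P_1P_2P_3$ inscribed in $E$ such that at each vertex the normal to $E$ bisects the interior angle of the triangle. For a fixed ellipse $E$ these triangles form a one-parameter family (the 3-periodic family); a quantity is conserved by the family if it takes the same value on all of its members. Excentral triangle of $P_1P_2P_3$: through each $P_i$ draw the line perpendicular to the interior angle bisector at $P_i$; the excentral triangle is the triangle whose vertices are the three pairwise intersections of these lines (the excenters). *)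

theory Defs
  imports "HOL-Analysis.Analysis"
begin

definition ellipse :: "real \<Rightarrow> real \<Rightarrow> (real ^ 2) set" where
  "ellipse a b = {P. (P $ 1)\<^sup>2 / a\<^sup>2 + (P $ 2)\<^sup>2 / b\<^sup>2 = 1}"

(* The direction is half the gradient of x^2/a^2 + y^2/b^2 at P. *)
definition ellipse_normal_line :: "real \<Rightarrow> real \<Rightarrow> real ^ 2 \<Rightarrow> (real ^ 2) set" where
  "ellipse_normal_line a b P = {P + t *\<^sub>R vector [P $ 1 / a\<^sup>2, P $ 2 / b\<^sup>2] | t. True}"

(* Unsigned angle Q P R at the vertex P, in [0, pi]; only meaningful for Q \<noteq> P and R \<noteq> P. *)
definition angle_at :: "real ^ 2 \<Rightarrow> real ^ 2 \<Rightarrow> real ^ 2 \<Rightarrow> real" where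
  "angle_at Q P R = arccos (((Q - P) \<bullet> (R - P)) / (norm (Q - P) * norm (R - P)))"

(* The closed ray from P that halves the angle Q P R (for P, Q, R not collinear);
   the vertex is added separately because angle_at has no meaning for X = P. *)
definition interior_bisector :: "real ^ 2 \<Rightarrow> real ^ 2 \<Rightarrow> real ^ 2 \<Rightarrow> (real ^ 2) set" where
  "interior_bisector Q P R =
     insert P {X. X \<noteq> P \<and> angle_at Q P X = angle_at Q P R / 2 \<and> angle_at X P R = angle_at Q P R / 2}"

definition three_periodic :: "real \<Rightarrow> real \<Rightarrow> real ^ 2 \<Rightarrow> real ^ 2 \<Rightarrow> real ^ 2 \<Rightarrow> bool" where
  "three_periodic a b P1 P2 P3 \<longleftrightarrow>
     P1 \<in> ellipse a b \<and> P2 \<in> ellipse a b \<and> P3 \<in> ellipse a b \<and>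
     \<not> collinear {P1, P2, P3} \<and>
     affine hull (interior_bisector P3 P1 P2) = ellipse_normal_line a b P1 \<and>
     affine hull (interior_bisector P1 P2 P3) = ellipse_normal_line a b P2 \<and>
     affine hull (interior_bisector P2 P3 P1) = ellipse_normal_line a b P3"

(* The line through P perpendicular to the interior bisector at P. *)
definition bisector_perp :: "real ^ 2 \<Rightarrow> real ^ 2 \<Rightarrow> real ^ 2 \<Rightarrow> (real ^ 2) set" where
  "bisector_perp Q P R = {X. \<forall>Y \<in> interior_bisector Q P R. (X - P) \<bullet> (Y - P) = 0}"

(* For P1, P2, P3 not collinear, each of the three intersections is a single point. *)
definition excentral_vertices :: "real ^ 2 \<Rightarrow> real ^ 2 \<Rightarrow> real ^ 2 \<Rightarrow> (real ^ 2) set" where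
  "excentral_vertices P1 P2 P3 =
     (let L1 = bisector_perp P3 P1 P2; L2 = bisector_perp P1 P2 P3; L3 = bisector_perp P2 P3 P1
      in (L2 \<inter> L3) \<union> (L3 \<inter> L1) \<union> (L1 \<inter> L2))"

definition triangle_area :: "real ^ 2 \<Rightarrow> real ^ 2 \<Rightarrow> real ^ 2 \<Rightarrow> real" where
  "triangle_area P1 P2 P3 = measure lborel (convex hull {P1, P2, P3})"

definition excentral_area :: "real ^ 2 \<Rightarrow> real ^ 2 \<Rightarrow> real ^ 2 \<Rightarrow> real" where
  "excentral_area P1 P2 P3 = measure lborel (convex hull (excentral_vertices P1 P2 P3))"

end

theory Submission
  imports Defs
begin

text \<open>
  Write the vertices in the coordinates \<open>u = (x / a, y / b)\<close>, so that they lie on the unit circle.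
  Since the normal bisects the angle, \<open>(1 - u\<^sub>i \<bullet> u\<^sub>j) / dist P\<^sub>i P\<^sub>j\<close> is the same number \<open>k\<close> for all
  three sides (Joachimsthal's integral). Squaring and cancelling \<open>1 - u\<^sub>i \<bullet> u\<^sub>j\<close>, which up to
  a factor is the squared chord, gives \<open>u\<^sub>i \<bullet> B u\<^sub>j = r\<close> for \<open>i \<noteq> j\<close> with \<open>B = diag(p, q)\<close>,
  where \<open>p\<close>, \<open>q\<close>, \<open>r\<close> depend only on \<open>k\<^sup>2\<close>, \<open>a\<close>, \<open>b\<close>, and \<open>p + q = 2\<close>.

  Let \<open>w\<^sub>i\<close> be the barycentric coordinates of the centre in the triangle \<open>u\<^sub>1 u\<^sub>2 u\<^sub>3\<close> and
  \<open>M = \<Sum> w\<^sub>i u\<^sub>i u\<^sub>i\<^sup>T\<close>. The relations above say that \<open>M B = - r I\<close>. As \<open>M\<close> has trace 1, this yields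
  \<open>p q = - 2 r\<close>, a quadratic equation with exactly one positive root \<open>k\<^sup>2\<close>; hence \<open>r\<close> is
  determined by \<open>a\<close> and \<open>b\<close>. It also yields \<open>det M = - r / 2\<close>. The excentral triangle is bounded
  by the tangents at the vertices, and its area is \<open>1 / \<bar>det M\<bar> = 2 / \<bar>r\<bar>\<close> times that of the
  inscribed triangle.
\<close>

section \<open>Algebra of three points on the unit circle\<close>

text \<open>For points at angles \<open>s\<close> and \<open>t\<close> the factors are
  \<open>1 - cos (s - t)\<close> and \<open>1 - cos (s + t)\<close>, respectively
  \<open>1 + cos (s + t)\<close>.\<close>

lemma unit_circle_chord:
  fixes x1 y1 x2 y2 :: real
  assumes "x1\<^sup>2 + y1\<^sup>2 = 1" "x2\<^sup>2 + y2\<^sup>2 = 1"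
  shows "(x1 - x2)\<^sup>2 = (1 - x1 * x2 - y1 * y2) * (1 - x1 * x2 + y1 * y2)"
    and "(y1 - y2)\<^sup>2 = (1 - x1 * x2 - y1 * y2) * (1 + x1 * x2 - y1 * y2)"
  using assms by algebra+

text \<open>Three points on one line through the origin span a triangle of area 0.\<close>

lemma affine_kernel_trivial:
  fixes x1 x2 x3 y1 y2 y3 \<alpha> \<beta> :: real
  assumes "(x2 * y3 - x3 * y2) + (x3 * y1 - x1 * y3) + (x1 * y2 - x2 * y1) \<noteq> 0"
    and "\<alpha> * x1 + \<beta> * y1 = 0" "\<alpha> * x2 + \<beta> * y2 = 0" "\<alpha> * x3 + \<beta> * y3 = 0"
  shows "\<alpha> = 0" "\<beta> = 0"
proof -
  let ?D = "(x2 * y3 - x3 * y2) + (x3 * y1 - x1 * y3) + (x1 * y2 - x2 * y1)"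
  have "\<alpha> * ?D = 0" "\<beta> * ?D = 0"
    using assms(2-4) by algebra+
  then show "\<alpha> = 0" "\<beta> = 0" using assms(1) by auto
qed

text \<open>
  Here \<open>C\<^sub>i = D w\<^sub>i\<close>, so the conclusions are the four entries of \<open>M B = - r I\<close>, multiplied by \<open>D\<close>.
\<close>
lemma weighted_moments:
  fixes x1 x2 x3 y1 y2 y3 p q r C1 C2 C3 D :: real
  defines "C1 \<equiv> x2 * y3 - x3 * y2" and "C2 \<equiv> x3 * y1 - x1 * y3" and "C3 \<equiv> x1 * y2 - x2 * y1"
  defines "D \<equiv> C1 + C2 + C3"
  assumes D: "D \<noteq> 0"
    and e12: "p * x1 * x2 + q * y1 * y2 = r"
    and e23: "p * x2 * x3 + q * y2 * y3 = r"
    and e31: "p * x3 * x1 + q * y3 * y1 = r"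
  shows "p * (C1 * x1\<^sup>2 + C2 * x2\<^sup>2 + C3 * x3\<^sup>2) = - r * D"
    and "q * (C1 * y1\<^sup>2 + C2 * y2\<^sup>2 + C3 * y3\<^sup>2) = - r * D"
    and "p * (C1 * x1 * y1 + C2 * x2 * y2 + C3 * x3 * y3) = 0"
    and "q * (C1 * x1 * y1 + C2 * x2 * y2 + C3 * x3 * y3) = 0"
proof -
  let ?mxx = "C1 * x1\<^sup>2 + C2 * x2\<^sup>2 + C3 * x3\<^sup>2"
  let ?myy = "C1 * y1\<^sup>2 + C2 * y2\<^sup>2 + C3 * y3\<^sup>2"
  let ?mxy = "C1 * x1 * y1 + C2 * x2 * y2 + C3 * x3 * y3"
  have x: "C1 * x1 + C2 * x2 + C3 * x3 = 0" and y: "C1 * y1 + C2 * y2 + C3 * y3 = 0"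
    unfolding C1_def C2_def C3_def by algebra+
  \<comment> \<open>Pair \<open>C1 * u1 + C2 * u2 + C3 * u3 = 0\<close> with \<open>B u1\<close>:
    both mixed products are \<open>r\<close>, and \<open>C2 + C3 = D - C1\<close>. The others are
    cyclic.\<close>
  have d1: "C1 * (p * x1\<^sup>2 + q * y1\<^sup>2 - r) = - r * D"
    and d2: "C2 * (p * x2\<^sup>2 + q * y2\<^sup>2 - r) = - r * D"
    and d3: "C3 * (p * x3\<^sup>2 + q * y3\<^sup>2 - r) = - r * D"
    using x y e12 e23 e31 D_def by algebra+
  \<comment> \<open>The first row of \<open>M B + r I\<close>, times \<open>D\<close>, vanishes on
    all three points; the second row follows below.\<close>
  have "(p * ?mxx + r * D) * x1 + q * ?mxy * y1 = 0"
    "(p * ?mxx + r * D) * x2 + q * ?mxy * y2 = 0"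
    "(p * ?mxx + r * D) * x3 + q * ?mxy * y3 = 0"
    using x d1 d2 d3 e12 e23 e31 by algebra+
  from affine_kernel_trivial[OF _ this] D
  show "p * ?mxx = - r * D" "q * ?mxy = 0"
    unfolding D_def C1_def C2_def C3_def by auto
  have "p * ?mxy * x1 + (q * ?myy + r * D) * y1 = 0"
    "p * ?mxy * x2 + (q * ?myy + r * D) * y2 = 0"
    "p * ?mxy * x3 + (q * ?myy + r * D) * y3 = 0"
    using y d1 d2 d3 e12 e23 e31 by algebra+
  from affine_kernel_trivial[OF _ this] D
  show "q * ?myy = - r * D" "p * ?mxy = 0"
    unfolding D_def C1_def C2_def C3_def by auto
qed

lemma equal_products_on_unit_circle:
  fixes x1 x2 x3 y1 y2 y3 p q r C1 C2 C3 D :: real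
  defines "C1 \<equiv> x2 * y3 - x3 * y2" and "C2 \<equiv> x3 * y1 - x1 * y3" and "C3 \<equiv> x1 * y2 - x2 * y1"
  defines "D \<equiv> C1 + C2 + C3"
  assumes D: "D \<noteq> 0"
    and u: "x1\<^sup>2 + y1\<^sup>2 = 1" "x2\<^sup>2 + y2\<^sup>2 = 1" "x3\<^sup>2 + y3\<^sup>2 = 1"
    and pq: "p + q = 2"
    and e: "p * x1 * x2 + q * y1 * y2 = r" "p * x2 * x3 + q * y2 * y3 = r"
      "p * x3 * x1 + q * y3 * y1 = r"
  shows "p * q = - 2 * r" and "r = 0 \<or> 2 * (C1 * C2 * C3) = - r * D"
proof -
  let ?mxx = "C1 * x1\<^sup>2 + C2 * x2\<^sup>2 + C3 * x3\<^sup>2"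
  let ?myy = "C1 * y1\<^sup>2 + C2 * y2\<^sup>2 + C3 * y3\<^sup>2"
  let ?mxy = "C1 * x1 * y1 + C2 * x2 * y2 + C3 * x3 * y3"
  have m: "p * ?mxx = - r * D" "q * ?myy = - r * D" "p * ?mxy = 0" "q * ?mxy = 0"
    using weighted_moments[OF D[unfolded D_def C1_def C2_def C3_def] e]
    unfolding D_def C1_def C2_def C3_def by auto
  have trace: "?mxx + ?myy = D"
    unfolding D_def using u by algebra
  have "(p * q + 2 * r) * D = 0"
    using m(1,2) trace pq by algebra
  with D show 1: "p * q = - 2 * r" by auto
  have "?mxy = 0" using m(3,4) pq by auto
  \<comment> \<open>Cauchy-Binet: the pairwise determinants are again the \<open>C\<close>s, so the
    left side is the sum of the terms \<open>C1 * C2 * C3\<^sup>2\<close>.\<close>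
  moreover have det: "?mxx * ?myy - ?mxy\<^sup>2 = D * (C1 * C2 * C3)"
    unfolding D_def C1_def C2_def C3_def by algebra
  ultimately have "r * D * (2 * (C1 * C2 * C3) + r * D) = 0"
    using m(1,2) 1 by algebra
  with D show "r = 0 \<or> 2 * (C1 * C2 * C3) = - r * D" by auto
qed

section \<open>Reflection law and Joachimsthal's integral\<close>

text \<open>If the bisector were only \<open>{P}\<close>, its affine hull would be a point and not a
  line. The sign of \<open>t\<close> is left open.\<close>

lemma bisector_along_normal:
  assumes "a > 0" "b > 0" "P \<in> ellipse a b"
    and hull: "affine hull (interior_bisector Q P R) = ellipse_normal_line a b P"
  obtains t where "t \<noteq> 0"
    and "P + t *\<^sub>R vector [P $ 1 / a\<^sup>2, P $ 2 / b\<^sup>2] \<in> interior_bisector Q P R"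
proof -
  define n :: "real ^ 2" where "n = vector [P $ 1 / a\<^sup>2, P $ 2 / b\<^sup>2]"
  have "n \<noteq> 0"
    using assms(1-3) by (auto simp: n_def ellipse_def vec_eq_iff forall_2)
  have "P + 1 *\<^sub>R n \<in> affine hull (interior_bisector Q P R)"
    unfolding hull ellipse_normal_line_def n_def by blast
  moreover have "P + 1 *\<^sub>R n \<noteq> P" using \<open>n \<noteq> 0\<close> by simp
  ultimately have "\<not> affine hull (interior_bisector Q P R) \<subseteq> {P}" by blast
  then have "\<not> interior_bisector Q P R \<subseteq> {P}"
    using hull_minimal[of "interior_bisector Q P R" "{P}" affine, OF _ affine_sing] by (rule contrapos_nn)
  then obtain Y where Y: "Y \<in> interior_bisector Q P R" "Y \<noteq> P" by auto
  then have "Y \<in> ellipse_normal_line a b P"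
    using hull hull_subset[of "interior_bisector Q P R" affine] by blast
  then obtain t where "Y = P + t *\<^sub>R n"
    unfolding ellipse_normal_line_def n_def by blast
  with Y that show thesis unfolding n_def by auto
qed

text \<open>All bisector points lie on the normal and one differs from \<open>P\<close>, so the
  perpendicular is the tangent, written as the polar line of \<open>P\<close>.\<close>

lemma bisector_perp_eq_tangent:
  assumes "a > 0" "b > 0" "P \<in> ellipse a b"
    and hull: "affine hull (interior_bisector Q P R) = ellipse_normal_line a b P"
  shows "bisector_perp Q P R = {X. P $ 1 * X $ 1 / a\<^sup>2 + P $ 2 * X $ 2 / b\<^sup>2 = 1}"
proof -
  define n :: "real ^ 2" where "n = vector [P $ 1 / a\<^sup>2, P $ 2 / b\<^sup>2]"
  obtain t where t: "t \<noteq> 0" "P + t *\<^sub>R n \<in> interior_bisector Q P R"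
    using bisector_along_normal[OF assms] unfolding n_def by blast
  have on_normal: "\<exists>s. Y = P + s *\<^sub>R n" if "Y \<in> interior_bisector Q P R" for Y
    using that hull hull_subset[of "interior_bisector Q P R" affine]
    unfolding ellipse_normal_line_def n_def by blast
  have "X \<in> bisector_perp Q P R \<longleftrightarrow> (X - P) \<bullet> n = 0" for X
    using t on_normal unfolding bisector_perp_def by fastforce
  moreover have "(X - P) \<bullet> n = P $ 1 * X $ 1 / a\<^sup>2 + P $ 2 * X $ 2 / b\<^sup>2 - 1" for X
    using assms(3)
    by (simp add: n_def ellipse_def inner_vec_def sum_2 diff_divide_distrib algebra_simps
        power2_eq_square)
  ultimately show ?thesis by auto
qed

lemma angle_at_eqD:
  assumes "Q \<noteq> P" "R \<noteq> P" "Y \<noteq> P" "angle_at Q P Y = angle_at Y P R"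
  shows "(Y - P) \<bullet> (Q - P) / norm (Q - P) = (Y - P) \<bullet> (R - P) / norm (R - P)"
proof -
  \<comment> \<open>\<open>arccos\<close> is injective only on [-1, 1].\<close>
  have bound: "\<bar>u \<bullet> v / (norm u * norm v)\<bar> \<le> 1" for u v :: "real ^ 2"
    using Cauchy_Schwarz_ineq2[of u v] by (auto simp: abs_mult divide_le_eq_1)
  have "(Q - P) \<bullet> (Y - P) / (norm (Q - P) * norm (Y - P)) =
      (Y - P) \<bullet> (R - P) / (norm (Y - P) * norm (R - P))"
    using assms(4) bound unfolding angle_at_def by (subst (asm) arccos_eq_iff) auto
  then show ?thesis using assms(1-3) by (simp add: field_simps inner_commute)
qed

text \<open>Each side is minus the inner product of the normal vector with the unit vector along one
  segment; equal angles with the normal make these agree.\<close>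

lemma equal_normal_components:
  assumes "a > 0" "b > 0" "P \<in> ellipse a b" "Q \<noteq> P" "R \<noteq> P"
    and "affine hull (interior_bisector Q P R) = ellipse_normal_line a b P"
  shows "(1 - (P $ 1 * Q $ 1 / a\<^sup>2 + P $ 2 * Q $ 2 / b\<^sup>2)) / dist P Q =
         (1 - (P $ 1 * R $ 1 / a\<^sup>2 + P $ 2 * R $ 2 / b\<^sup>2)) / dist P R"
proof -
  define n :: "real ^ 2" where "n = vector [P $ 1 / a\<^sup>2, P $ 2 / b\<^sup>2]"
  obtain t where t: "t \<noteq> 0" "P + t *\<^sub>R n \<in> interior_bisector Q P R"
    using bisector_along_normal[OF assms(1-3,6)] unfolding n_def by blast
  have "n \<noteq> 0"
    using assms(1-3) by (auto simp: n_def ellipse_def vec_eq_iff forall_2)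
  with t have "P + t *\<^sub>R n \<noteq> P"
    "angle_at Q P (P + t *\<^sub>R n) = angle_at (P + t *\<^sub>R n) P R"
    unfolding interior_bisector_def by auto
  from angle_at_eqD[OF assms(4,5) this]
  have "t * (n \<bullet> (Q - P) / norm (Q - P)) = t * (n \<bullet> (R - P) / norm (R - P))" by simp
  with t(1) have eq: "n \<bullet> (Q - P) / norm (Q - P) = n \<bullet> (R - P) / norm (R - P)"
    by (simp only: mult_cancel_left) simp
  have n: "1 - (P $ 1 * X $ 1 / a\<^sup>2 + P $ 2 * X $ 2 / b\<^sup>2) = - (n \<bullet> (X - P))" for X
    using assms(3)
    by (simp add: n_def ellipse_def inner_vec_def sum_2 diff_divide_distrib algebra_simps
        power2_eq_square)
  have d: "dist P X = norm (X - P)" for X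
    by (simp add: dist_norm norm_minus_commute)
  show ?thesis
    unfolding n d minus_divide_left[symmetric] eq ..
qed

text \<open>The squared distance also contains the factor \<open>1 - c\<close>; cancelling it from
  the squared integral leaves a relation linear in each point.\<close>

lemma joachimsthal_product:
  fixes a b k x1 y1 x2 y2 :: real and P Q :: "real ^ 2"
  assumes u: "x1\<^sup>2 + y1\<^sup>2 = 1" "x2\<^sup>2 + y2\<^sup>2 = 1"
    and P: "P $ 1 = a * x1" "P $ 2 = b * y1" and Q: "Q $ 1 = a * x2" "Q $ 2 = b * y2"
    and "P \<noteq> Q" and k: "k = (1 - (x1 * x2 + y1 * y2)) / dist P Q"
  shows "k \<noteq> 0"
    and "(1 - k\<^sup>2 * (a\<^sup>2 - b\<^sup>2)) * x1 * x2 + (1 + k\<^sup>2 * (a\<^sup>2 - b\<^sup>2)) * y1 * y2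
      = 1 - k\<^sup>2 * (a\<^sup>2 + b\<^sup>2)"
proof -
  define c where "c = x1 * x2 + y1 * y2"
  define e where "e = x1 * x2 - y1 * y2"
  have chord: "(x1 - x2)\<^sup>2 = (1 - c) * (1 - e)" "(y1 - y2)\<^sup>2 = (1 - c) * (1 + e)"
    using unit_circle_chord[OF u] by (simp_all add: c_def e_def algebra_simps)
  have c: "1 - c \<noteq> 0"
  proof
    assume "1 - c = 0"
    then have "x1 = x2" "y1 = y2" using chord by auto
    then have "P = Q" using P Q by (simp add: vec_eq_iff forall_2)
    then show False using \<open>P \<noteq> Q\<close> by simp
  qed
  show "k \<noteq> 0" using c \<open>P \<noteq> Q\<close> by (simp add: k c_def)
  have "(dist P Q)\<^sup>2 = a\<^sup>2 * (x1 - x2)\<^sup>2 + b\<^sup>2 * (y1 - y2)\<^sup>2"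
    unfolding dist_norm power2_norm_eq_inner
    by (simp add: inner_vec_def sum_2 P Q power2_eq_square algebra_simps)
  also have "\<dots> = (1 - c) * (a\<^sup>2 * (1 - e) + b\<^sup>2 * (1 + e))"
    unfolding chord by (simp add: algebra_simps)
  finally have d: "(dist P Q)\<^sup>2 = (1 - c) * (a\<^sup>2 * (1 - e) + b\<^sup>2 * (1 + e))" .
  have "1 - c = k * dist P Q" using \<open>P \<noteq> Q\<close> by (simp add: k c_def)
  then have "(1 - c)\<^sup>2 = k\<^sup>2 * (dist P Q)\<^sup>2" by (simp add: power_mult_distrib)
  then have "(1 - c) * (1 - c) = (1 - c) * (k\<^sup>2 * (a\<^sup>2 * (1 - e) + b\<^sup>2 * (1 + e)))"
    unfolding d by (simp add: power2_eq_square algebra_simps)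
  with c have "1 - c = k\<^sup>2 * (a\<^sup>2 * (1 - e) + b\<^sup>2 * (1 + e))" by simp
  then show "(1 - k\<^sup>2 * (a\<^sup>2 - b\<^sup>2)) * x1 * x2 + (1 + k\<^sup>2 * (a\<^sup>2 - b\<^sup>2)) * y1 * y2
      = 1 - k\<^sup>2 * (a\<^sup>2 + b\<^sup>2)"
    unfolding c_def e_def by (simp add: algebra_simps)
qed

section \<open>Areas and the tangent triangle\<close>

lemma triangle_area_scaled:
  assumes "P1 $ 1 = a * x1" "P1 $ 2 = b * y1" "P2 $ 1 = a * x2" "P2 $ 2 = b * y2"
    "P3 $ 1 = a * x3" "P3 $ 2 = b * y3"
  shows "triangle_area P1 P2 P3 =
    \<bar>a * b * ((x2 * y3 - x3 * y2) + (x3 * y1 - x1 * y3) + (x1 * y2 - x2 * y1))\<bar> / 2"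
proof -
  have "(P3 $ 1 - P1 $ 1) * (P2 $ 2 - P1 $ 2) - (P2 $ 1 - P1 $ 1) * (P3 $ 2 - P1 $ 2) =
    - (a * b * ((x2 * y3 - x3 * y2) + (x3 * y1 - x1 * y3) + (x1 * y2 - x2 * y1)))"
    unfolding assms by algebra
  then show ?thesis
    unfolding triangle_area_def content_triangle by simp
qed

text \<open>Cramer's rule in the scaled coordinates \<open>X $ 1 / a\<close>,
  \<open>X $ 2 / b\<close>.\<close>

lemma line_intersection:
  fixes a b x1 y1 x2 y2 :: real
  assumes "a > 0" "b > 0" "x1 * y2 - x2 * y1 \<noteq> 0"
  shows "{X :: real ^ 2. x1 * X $ 1 / a + y1 * X $ 2 / b = 1} \<inter>
      {X. x2 * X $ 1 / a + y2 * X $ 2 / b = 1} =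
    {vector [a * ((y2 - y1) / (x1 * y2 - x2 * y1)), b * ((x1 - x2) / (x1 * y2 - x2 * y1))]}"
    (is "?L = {?V}")
proof -
  have "X = ?V" if "x1 * X $ 1 / a + y1 * X $ 2 / b = 1" "x2 * X $ 1 / a + y2 * X $ 2 / b = 1"
    for X :: "real ^ 2"
  proof -
    define s where "s = X $ 1 / a"
    define t where "t = X $ 2 / b"
    have X: "X $ 1 = a * s" "X $ 2 = b * t" using assms by (simp_all add: s_def t_def)
    have "x1 * s + y1 * t = 1" "x2 * s + y2 * t = 1"
      using that by (simp_all add: s_def t_def)
    then have "s * (x1 * y2 - x2 * y1) = y2 - y1" "t * (x1 * y2 - x2 * y1) = x1 - x2"
      by algebra+
    then have "s = (y2 - y1) / (x1 * y2 - x2 * y1)" "t = (x1 - x2) / (x1 * y2 - x2 * y1)"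
      using assms(3) by (simp_all add: eq_divide_eq)
    with X show ?thesis by (simp add: vec_eq_iff forall_2)
  qed
  moreover have "x1 * ?V $ 1 / a + y1 * ?V $ 2 / b = 1" "x2 * ?V $ 1 / a + y2 * ?V $ 2 / b = 1"
    using assms by (simp_all add: divide_simps) (simp_all add: algebra_simps)
  ultimately show ?thesis by blast
qed

text \<open>Up to the signs of two columns, the rows \<open>Ci * (\<xi>i, \<eta>i, 1)\<close> form
  the cofactor matrix of the rows \<open>(xi, yi, 1)\<close>, whose determinant is the square of
  \<open>C1 + C2 + C3\<close>.\<close>

lemma tangent_triangle_determinant:
  fixes x1 x2 x3 y1 y2 y3 C1 C2 C3 :: real
  defines "C1 \<equiv> x2 * y3 - x3 * y2" and "C2 \<equiv> x3 * y1 - x1 * y3" and "C3 \<equiv> x1 * y2 - x2 * y1"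
  assumes "C1 \<noteq> 0" "C2 \<noteq> 0" "C3 \<noteq> 0"
  defines "\<xi>1 \<equiv> (y3 - y2) / C1" and "\<eta>1 \<equiv> (x2 - x3) / C1"
    and "\<xi>2 \<equiv> (y1 - y3) / C2" and "\<eta>2 \<equiv> (x3 - x1) / C2"
    and "\<xi>3 \<equiv> (y2 - y1) / C3" and "\<eta>3 \<equiv> (x1 - x2) / C3"
  shows "(\<xi>2 * \<eta>3 - \<xi>3 * \<eta>2) + (\<xi>3 * \<eta>1 - \<xi>1 * \<eta>3) + (\<xi>1 * \<eta>2 - \<xi>2 * \<eta>1) =
    (C1 + C2 + C3)\<^sup>2 / (C1 * C2 * C3)"
proof -
  have "C1 * \<xi>1 = y3 - y2" "C1 * \<eta>1 = x2 - x3" "C2 * \<xi>2 = y1 - y3" "C2 * \<eta>2 = x3 - x1"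
    "C3 * \<xi>3 = y2 - y1" "C3 * \<eta>3 = x1 - x2"
    using assms(4-6) by (simp_all add: \<xi>1_def \<eta>1_def \<xi>2_def \<eta>2_def \<xi>3_def \<eta>3_def)
  then have "((\<xi>2 * \<eta>3 - \<xi>3 * \<eta>2) + (\<xi>3 * \<eta>1 - \<xi>1 * \<eta>3) + (\<xi>1 * \<eta>2 - \<xi>2 * \<eta>1)) * (C1 * C2 * C3) =
    (C1 + C2 + C3)\<^sup>2"
    using C1_def C2_def C3_def by algebra
  then show ?thesis using assms(4-6) by (simp add: eq_divide_eq)
qed

text \<open>By Lagrange's identity, a vanishing cross product is the equality case of
  Cauchy-Schwarz.\<close>

lemma collinear_if_zero_determinant:
  fixes P1 P2 P3 :: "real ^ 2"
  assumes "(P1 $ 1 - P2 $ 1) * (P3 $ 2 - P2 $ 2) = (P1 $ 2 - P2 $ 2) * (P3 $ 1 - P2 $ 1)"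
  shows "collinear {P1, P2, P3}"
proof -
  define v where "v = P1 - P2"
  define w where "w = P3 - P2"
  have "v $ 1 * w $ 2 = v $ 2 * w $ 1" using assms by (simp add: v_def w_def)
  then have "(v $ 1 * w $ 1 + v $ 2 * w $ 2)\<^sup>2 =
      ((v $ 1)\<^sup>2 + (v $ 2)\<^sup>2) * ((w $ 1)\<^sup>2 + (w $ 2)\<^sup>2)"
    by algebra
  moreover have "v \<bullet> w = v $ 1 * w $ 1 + v $ 2 * w $ 2"
    by (simp add: inner_vec_def sum_2)
  moreover have "(norm u)\<^sup>2 = (u $ 1)\<^sup>2 + (u $ 2)\<^sup>2" for u :: "real ^ 2"
    unfolding power2_norm_eq_inner by (simp add: inner_vec_def sum_2 power2_eq_square)
  ultimately have "\<bar>v \<bullet> w\<bar>\<^sup>2 = (norm v * norm w)\<^sup>2"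
    by (simp only: power_mult_distrib power2_abs)
  then have "\<bar>v \<bullet> w\<bar> = norm v * norm w"
    by (rule power2_eq_imp_eq) simp_all
  then show ?thesis
    unfolding norm_cauchy_schwarz_equal v_def w_def by (subst collinear_3) simp_all
qed

section \<open>The ratio in terms of \<open>a\<close> and \<open>b\<close>\<close>

lemma positive_quadratic_root_unique:
  fixes l m s t :: real
  assumes "l > 0" "m > 0" "s > 0" "t \<ge> 0"
    and "s * l + t * l\<^sup>2 = s * m + t * m\<^sup>2"
  shows "l = m"
proof -
  have "(l - m) * (s + t * (l + m)) = 0"
    using assms(5) by algebra
  moreover have "s + t * (l + m) > 0"
    using assms by (intro add_pos_nonneg) auto
  ultimately show ?thesis by simp
qed

text \<open>\<open>l\<close> is \<open>k\<^sup>2\<close>. The quadratic is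
  \<open>p * q = - 2 * r\<close> written out; its coefficients involve only \<open>a\<close> and
  \<open>b\<close>, so the values of \<open>l\<close> for two triangles can be compared.\<close>

lemma area_ratio:
  fixes a b :: real
  assumes ab: "a > 0" "b > 0" and T: "three_periodic a b P1 P2 P3"
  obtains l where "l > 0" "2 * (a\<^sup>2 + b\<^sup>2) * l + (a\<^sup>2 - b\<^sup>2)\<^sup>2 * l\<^sup>2 = 3"
    and "excentral_area P1 P2 P3 / triangle_area P1 P2 P3 = 2 / \<bar>1 - l * (a\<^sup>2 + b\<^sup>2)\<bar>"
proof -
  define x1 where "x1 = P1 $ 1 / a"
  define y1 where "y1 = P1 $ 2 / b"
  define x2 where "x2 = P2 $ 1 / a"
  define y2 where "y2 = P2 $ 2 / b"
  define x3 where "x3 = P3 $ 1 / a"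
  define y3 where "y3 = P3 $ 2 / b"
  define C1 where "C1 = x2 * y3 - x3 * y2"
  define C2 where "C2 = x3 * y1 - x1 * y3"
  define C3 where "C3 = x1 * y2 - x2 * y1"
  define D where "D = C1 + C2 + C3"
  note C_defs = D_def C1_def C2_def C3_def
  have P: "P1 $ 1 = a * x1" "P1 $ 2 = b * y1" "P2 $ 1 = a * x2" "P2 $ 2 = b * y2"
    "P3 $ 1 = a * x3" "P3 $ 2 = b * y3"
    using ab by (simp_all add: x1_def y1_def x2_def y2_def x3_def y3_def)
  have E: "P1 \<in> ellipse a b" "P2 \<in> ellipse a b" "P3 \<in> ellipse a b"
    and nc: "\<not> collinear {P1, P2, P3}"
    and bis: "affine hull (interior_bisector P3 P1 P2) = ellipse_normal_line a b P1"
      "affine hull (interior_bisector P1 P2 P3) = ellipse_normal_line a b P2"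
      "affine hull (interior_bisector P2 P3 P1) = ellipse_normal_line a b P3"
    using T unfolding three_periodic_def by auto
  have u: "x1\<^sup>2 + y1\<^sup>2 = 1" "x2\<^sup>2 + y2\<^sup>2 = 1" "x3\<^sup>2 + y3\<^sup>2 = 1"
    using E by (simp_all add: ellipse_def x1_def y1_def x2_def y2_def x3_def y3_def power_divide)
  have ne: "P1 \<noteq> P2" "P2 \<noteq> P3" "P3 \<noteq> P1"
    using nc by (auto simp: insert_commute)
  have D: "D \<noteq> 0"
  proof
    assume "D = 0"
    then have "(P1 $ 1 - P2 $ 1) * (P3 $ 2 - P2 $ 2) = (P1 $ 2 - P2 $ 2) * (P3 $ 1 - P2 $ 1)"
      unfolding P C_defs by algebra
    with nc show False using collinear_if_zero_determinant by blast
  qed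
  define k where "k = (1 - (x1 * x2 + y1 * y2)) / dist P1 P2"
  have coord: "P $ 1 * Q $ 1 / a\<^sup>2 = (P $ 1 / a) * (Q $ 1 / a)"
    "P $ 2 * Q $ 2 / b\<^sup>2 = (P $ 2 / b) * (Q $ 2 / b)" for P Q :: "real ^ 2"
    by (simp_all add: power2_eq_square)
  \<comment> \<open>The bounce at \<open>P2\<close> carries \<open>k\<close> from side
    \<open>P1 P2\<close> to \<open>P2 P3\<close>, the one at \<open>P1\<close> carries it to
    \<open>P3 P1\<close>.\<close>
  have k2: "k = (1 - (x2 * x3 + y2 * y3)) / dist P2 P3"
    using equal_normal_components[OF ab E(2) _ _ bis(2)] ne
    by (simp add: coord k_def x1_def y1_def x2_def y2_def x3_def y3_def dist_commute mult.commute)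
  have k3: "k = (1 - (x3 * x1 + y3 * y1)) / dist P3 P1"
    using equal_normal_components[OF ab E(1) _ _ bis(1)] ne
    by (simp add: coord k_def x1_def y1_def x2_def y2_def x3_def y3_def dist_commute mult.commute)
  define l where "l = k\<^sup>2"
  define p where "p = 1 - l * (a\<^sup>2 - b\<^sup>2)"
  define q where "q = 1 + l * (a\<^sup>2 - b\<^sup>2)"
  define r where "r = 1 - l * (a\<^sup>2 + b\<^sup>2)"
  have e: "p * x1 * x2 + q * y1 * y2 = r" "p * x2 * x3 + q * y2 * y3 = r"
      "p * x3 * x1 + q * y3 * y1 = r"
    unfolding p_def q_def r_def l_def
    by (rule joachimsthal_product(2)[OF u(1,2) P(1-4) ne(1) k_def]
      joachimsthal_product(2)[OF u(2,3) P(3-6) ne(2) k2]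
      joachimsthal_product(2)[OF u(3,1) P(5,6,1,2) ne(3) k3])+
  have l: "l > 0"
    using joachimsthal_product(1)[OF u(1,2) P(1-4) ne(1) k_def] by (simp add: l_def)
  have "p + q = 2" by (simp add: p_def q_def)
  note main = equal_products_on_unit_circle[OF D[unfolded C_defs] u this e, folded C_defs]
  have quad: "2 * (a\<^sup>2 + b\<^sup>2) * l + (a\<^sup>2 - b\<^sup>2)\<^sup>2 * l\<^sup>2 = 3"
    using main(1) unfolding p_def q_def r_def by algebra
  \<comment> \<open>With \<open>r = 0\<close> both \<open>p\<close> and \<open>q\<close> would be
    positive, against \<open>p * q = - 2 * r\<close>.\<close>
  have r0: "r \<noteq> 0"
  proof
    assume "r = 0"
    then have "p = 2 * l * b\<^sup>2" "q = 2 * l * a\<^sup>2"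
      unfolding p_def q_def r_def by (simp_all add: algebra_simps)
    then have "p * q > 0" using l ab by simp
    with main(1) \<open>r = 0\<close> show False by linarith
  qed
  with main(2) have C: "2 * (C1 * C2 * C3) = - r * D" by blast
  \<comment> \<open>No two of the three tangents are parallel.\<close>
  have C0: "C1 \<noteq> 0" "C2 \<noteq> 0" "C3 \<noteq> 0"
    using C r0 D by auto
  define V1 :: "real ^ 2" where "V1 = vector [a * ((y3 - y2) / C1), b * ((x2 - x3) / C1)]"
  define V2 :: "real ^ 2" where "V2 = vector [a * ((y1 - y3) / C2), b * ((x3 - x1) / C2)]"
  define V3 :: "real ^ 2" where "V3 = vector [a * ((y2 - y1) / C3), b * ((x1 - x2) / C3)]"
  have tangent: "bisector_perp P3 P1 P2 = {X. x1 * X $ 1 / a + y1 * X $ 2 / b = 1}"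
    "bisector_perp P1 P2 P3 = {X. x2 * X $ 1 / a + y2 * X $ 2 / b = 1}"
    "bisector_perp P2 P3 P1 = {X. x3 * X $ 1 / a + y3 * X $ 2 / b = 1}"
    using bisector_perp_eq_tangent[OF ab E(1) bis(1)] bisector_perp_eq_tangent[OF ab E(2) bis(2)]
      bisector_perp_eq_tangent[OF ab E(3) bis(3)]
    by (simp_all add: coord x1_def y1_def x2_def y2_def x3_def y3_def)
  have "excentral_vertices P1 P2 P3 = {V1} \<union> {V2} \<union> {V3}"
    unfolding excentral_vertices_def Let_def tangent V1_def V2_def V3_def C1_def C2_def C3_def
      line_intersection[OF ab C0(1)[unfolded C1_def]]
      line_intersection[OF ab C0(2)[unfolded C2_def]]
      line_intersection[OF ab C0(3)[unfolded C3_def]] ..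
  then have "excentral_area P1 P2 P3 = triangle_area V1 V2 V3"
    unfolding excentral_area_def triangle_area_def by (simp add: insert_commute)
  also have "\<dots> = \<bar>a * b * (D\<^sup>2 / (C1 * C2 * C3))\<bar> / 2"
    unfolding D_def C1_def C2_def C3_def
      tangent_triangle_determinant[OF C0[unfolded C1_def C2_def C3_def], symmetric]
    by (rule triangle_area_scaled) (simp_all add: V1_def V2_def V3_def C1_def C2_def C3_def)
  finally have A': "excentral_area P1 P2 P3 = \<bar>a * b * (D\<^sup>2 / (C1 * C2 * C3))\<bar> / 2" .
  have A: "triangle_area P1 P2 P3 = \<bar>a * b * D\<bar> / 2"
    using triangle_area_scaled[OF P] unfolding C_defs .
  have "excentral_area P1 P2 P3 = \<bar>D / (C1 * C2 * C3)\<bar> * triangle_area P1 P2 P3"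
    unfolding A A' by (simp add: abs_mult power2_eq_square)
  then have "excentral_area P1 P2 P3 / triangle_area P1 P2 P3 = \<bar>D / (C1 * C2 * C3)\<bar>"
    using ab D by (simp add: A)
  also have "C1 * C2 * C3 = - r * D / 2" using C by linarith
  also have "\<bar>D / (- r * D / 2)\<bar> = 2 / \<bar>r\<bar>" using D by (simp add: abs_mult)
  finally show thesis using that[OF l quad] unfolding r_def by blast
qed

theorem corollary4:
  fixes a b :: real and P1 P2 P3 Q1 Q2 Q3 :: "real ^ 2"
  assumes "a > 0" and "b > 0"
    and "three_periodic a b P1 P2 P3"
    and "three_periodic a b Q1 Q2 Q3"
  shows "excentral_area P1 P2 P3 / triangle_area P1 P2 P3 =
         excentral_area Q1 Q2 Q3 / triangle_area Q1 Q2 Q3"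
proof -
  obtain l where l: "l > 0" "2 * (a\<^sup>2 + b\<^sup>2) * l + (a\<^sup>2 - b\<^sup>2)\<^sup>2 * l\<^sup>2 = 3"
    "excentral_area P1 P2 P3 / triangle_area P1 P2 P3 = 2 / \<bar>1 - l * (a\<^sup>2 + b\<^sup>2)\<bar>"
    using area_ratio[OF assms(1-3)] .
  obtain m where m: "m > 0" "2 * (a\<^sup>2 + b\<^sup>2) * m + (a\<^sup>2 - b\<^sup>2)\<^sup>2 * m\<^sup>2 = 3"
    "excentral_area Q1 Q2 Q3 / triangle_area Q1 Q2 Q3 = 2 / \<bar>1 - m * (a\<^sup>2 + b\<^sup>2)\<bar>"
    using area_ratio[OF assms(1,2,4)] .
  have "2 * (a\<^sup>2 + b\<^sup>2) > 0" using assms(1) by (simp add: add_pos_nonneg)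
  then have "l = m"
    using positive_quadratic_root_unique[OF l(1) m(1), of "2 * (a\<^sup>2 + b\<^sup>2)" "(a\<^sup>2 - b\<^sup>2)\<^sup>2"]
      l(2) m(2) by simp
  with l(3) m(3) show ?thesis by simp
qed

end
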